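(* For all integers $n\ge1$, the median Genocchi number $h_n$ is equal to the number of permutations $\sigma$ of $[2n]$ having only even-odd drops, i.e. permutations $\sigma$ such that for every $i\in[2n]$ with $i>\sigma(i)$, $i$ is even and $\sigma(i)$ is odd.
   Context: $[m]=\{1,\dots,m\}$. A Dumont derangement on $[2m]$ is a permutation $\sigma$ of $[2m]$ with $2i>\sigma(2i)$ and $2i-1<\sigma(2i-1)$ for all $i=1,\dots,m$. For $n\ge0$ the median Genocchi number $h_n$ is defined as the number of Dumont derangements on $[2n+2]$ (so $h_0,h_1,\ldots=1,2,8,56,608,\dots$). *)

theory Defs
  imports "HOL-Combinatorics.Permutations"
begin

text \<open>
  Permutations of a set \<open>S\<close> are represented by \<^const>\<open>permutes\<close>, so they fix every point outside \<open>S\<close>;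
  hence distinct permutations of \<open>S\<close> are distinct functions and counting them with \<^const>\<open>card\<close> is
  counting permutations of \<open>S\<close>.
\<close>

definition dumont_derangement :: "nat \<Rightarrow> (nat \<Rightarrow> nat) \<Rightarrow> bool" where
  "dumont_derangement m \<sigma> \<longleftrightarrow>
     \<sigma> permutes {1..2*m} \<and>
     (\<forall>i\<in>{1..m}. 2*i > \<sigma> (2*i) \<and> 2*i - 1 < \<sigma> (2*i - 1))"

definition median_genocchi :: "nat \<Rightarrow> nat" where
  "median_genocchi n = card {\<sigma>. dumont_derangement (n + 1) \<sigma>}"

definition only_even_odd_drops :: "nat set \<Rightarrow> (nat \<Rightarrow> nat) \<Rightarrow> bool" where
  "only_even_odd_drops S \<sigma> \<longleftrightarrow> (\<forall>i\<in>S. i > \<sigma> i \<longrightarrow> even i \<and> odd (\<sigma> i))"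

end

theory Submission
  imports Defs
begin

text \<open>
  Build the permutation matrix by adding rows and columns alternately, remembering only how many
  rows and columns are still to be matched; in both problems the weight of a step depends only on
  these numbers. On states with \<open>k\<close> open rows and \<open>k\<close> open columns this gives, with
  \<open>A' e\<^sub>k = (k + 1) e\<^sub>k + e\<^sub>k\<^sub>+\<^sub>1\<close> and \<open>B' e\<^sub>k = (k + 1) e\<^sub>k + k\<^sup>2 e\<^sub>k\<^sub>-\<^sub>1\<close> for the even-odd drops and
  \<open>A e\<^sub>k = k e\<^sub>k + e\<^sub>k\<^sub>+\<^sub>1\<close> and \<open>B e\<^sub>k = k e\<^sub>k + k\<^sup>2 e\<^sub>k\<^sub>-\<^sub>1\<close> for Dumont derangements, the counts
  \<open>\<langle>e\<^sub>0, (B'A')\<^sup>n e\<^sub>0\<rangle>\<close> and \<open>\<langle>e\<^sub>0, (BA)\<^sup>n\<^sup>+\<^sup>1 e\<^sub>0\<rangle>\<close>. The identity \<open>BA = A'B'\<close> turns the latter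
  into \<open>\<langle>e\<^sub>0, A'(B'A')\<^sup>nB' e\<^sub>0\<rangle>\<close>, and \<open>B'\<close> fixes \<open>e\<^sub>0\<close> while \<open>A'\<close> preserves the coefficient
  of \<open>e\<^sub>0\<close>.
\<close>

section \<open>Partial placements and their growth by one row or column\<close>

text \<open>
  Graphs of partial injections from \<open>A\<close> to \<open>B\<close> compatible with \<open>R\<close> that leave \<open>i\<close> rows and \<open>j\<close>
  columns open; \<open>p\<close> and \<open>r\<close> single out the rows and columns that may wait for a later partner.
\<close>

definition placements ::
  "('a \<Rightarrow> 'b \<Rightarrow> bool) \<Rightarrow> ('a \<Rightarrow> bool) \<Rightarrow> ('b \<Rightarrow> bool) \<Rightarrow> 'a set \<Rightarrow> 'b set \<Rightarrow> nat \<Rightarrow> nat \<Rightarrow> ('a \<times> 'b) set set"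
  where "placements R p r A B i j =
    {f. f \<subseteq> A \<times> B \<and> (\<forall>(a, b)\<in>f. R a b) \<and> single_valued f \<and> single_valued (f\<inverse>) \<and>
        (\<forall>a\<in>A - Domain f. p a) \<and> (\<forall>b\<in>B - Range f. r b) \<and>
        card (A - Domain f) = i \<and> card (B - Range f) = j}"

lemma finite_placements: "finite A \<Longrightarrow> finite B \<Longrightarrow> finite (placements R p r A B i j)"
  by (rule finite_subset[of _ "Pow (A \<times> B)"]) (auto simp: placements_def)

lemma card_placements_empty:
  "card (placements R p r {} {} i j) = of_bool (i = 0 \<and> j = 0)"
proof -
  have "placements R p r {} {} i j = (if i = 0 \<and> j = 0 then {{}} else {})"
    by (auto simp: placements_def single_valued_def)
  then show ?thesis by simp
qed

text \<open>As an unrestricted rewrite rule this loops, since \<open>R\<close> unifies with its own converse.\<close>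

lemma card_placements_converse:
  "card (placements (\<lambda>b a. R a b) r p B A j i) = card (placements R p r A B i j)"
  by (rule bij_betw_same_card[of converse], rule bij_betwI[where g = converse])
    (auto simp: placements_def)

text \<open>Either the new row stays open or it takes a column that was open before. Open columns
  all satisfy \<open>r\<close>, so by the condition on \<open>R\<close> the row \<open>x\<close>
  fits all of them or none, and only their number matters.\<close>

lemma placements_insert_row:
  assumes fin: "finite A" "finite B" and x: "x \<notin> A"
    and c: "\<And>b. b \<in> B \<Longrightarrow> R x b \<longleftrightarrow> c \<and> r b"
  shows "placements R p r (insert x A) B i j =
    (if p x \<and> i > 0 then placements R p r A B (i - 1) j else {}) \<union>
    (if c then (\<lambda>(f, b). insert (x, b) f) `
       (SIGMA f:placements R p r A B i (Suc j). B - Range f) else {})"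
    (is "?L = ?O \<union> ?M")
proof (intro equalityI subsetI)
  fix f assume "f \<in> ?L"
  then have f: "f \<subseteq> insert x A \<times> B" "\<forall>(a, b)\<in>f. R a b" "single_valued f" "single_valued (f\<inverse>)"
    "\<forall>a\<in>insert x A - Domain f. p a" "\<forall>b\<in>B - Range f. r b"
    "card (insert x A - Domain f) = i" "card (B - Range f) = j"
    by (auto simp: placements_def)
  show "f \<in> ?O \<union> ?M"
  proof (cases "x \<in> Domain f")
    case False
    have "insert x A - Domain f = insert x (A - Domain f)" using False by auto
    then have "i = Suc (card (A - Domain f))" using f(7) x fin by simp
    moreover have "f \<subseteq> A \<times> B" using f(1) False by auto
    ultimately have "f \<in> ?O" using f False by (auto simp: placements_def)
    then show ?thesis by blast
  next
    case True
    then obtain b where b: "(x, b) \<in> f" by auto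
    define g where "g = f - {(x, b)}"
    have fg: "f = insert (x, b) g" using b by (auto simp: g_def)
    have xg: "x \<notin> Domain g" using f(3) b by (auto simp: g_def single_valued_def)
    have bg: "b \<notin> Range g" using f(4) b by (auto simp: g_def single_valued_def)
    have bB: "b \<in> B" using b f(1) by auto
    have cr: "c" "r b" using c[OF bB] f(2) b by auto
    have A: "A - Domain g = insert x A - Domain f" using x xg by (auto simp: fg)
    have B: "B - Range g = insert b (B - Range f)" "b \<notin> B - Range f"
      using bg bB by (auto simp: fg)
    \<comment> \<open>Deleting the pair reopens column \<open>b\<close>, which is admissible because
      \<open>R x b\<close> forces \<open>r b\<close>.\<close>
    have "g \<in> placements R p r A B i (Suc j)"
      unfolding placements_def A B(1) mem_Collect_eq
      using f(1,2) xg f(3-8) B(2) cr fin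
      by (auto simp: g_def single_valued_def)
    then have "f \<in> ?M" using cr bB bg fg by auto
    then show ?thesis by blast
  qed
next
  fix f assume "f \<in> ?O \<union> ?M"
  then show "f \<in> ?L"
  proof
    assume "f \<in> ?O"
    then have f: "p x" "i > 0" "f \<in> placements R p r A B (i - 1) j" by (auto split: if_splits)
    then have "insert x A - Domain f = insert x (A - Domain f)"
      using x by (auto simp: placements_def)
    then show ?thesis using f x fin by (auto simp: placements_def)
  next
    assume "f \<in> ?M"
    then obtain g b where g: "c" "f = insert (x, b) g" "g \<in> placements R p r A B i (Suc j)"
      and b: "b \<in> B" "b \<notin> Range g" by (auto split: if_splits)
    have xg: "x \<notin> Domain g" using g x by (auto simp: placements_def)
    have A: "insert x A - Domain f = A - Domain g" using x xg by (auto simp: g(2))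
    have B: "B - Range f = (B - Range g) - {b}" by (auto simp: g(2))
    have "R x b" using c[OF b(1)] g b by (auto simp: placements_def)
    then show ?thesis
      using g(3) xg b fin unfolding placements_def A B mem_Collect_eq
      by (auto simp: g(2) single_valued_def)
  qed
qed

lemma card_placements_insert_row:
  assumes fin: "finite A" "finite B" and x: "x \<notin> A"
    and c: "\<And>b. b \<in> B \<Longrightarrow> R x b \<longleftrightarrow> c \<and> r b"
  shows "card (placements R p r (insert x A) B i j) =
    (if p x \<and> i > 0 then card (placements R p r A B (i - 1) j) else 0) +
    (if c then Suc j * card (placements R p r A B i (Suc j)) else 0)"
proof -
  let ?S = "SIGMA f:placements R p r A B i (Suc j). B - Range f"
  have nx: "x \<notin> Domain f" if "f \<in> placements R p r A B k l" for f k l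
    using that x by (auto simp: placements_def)
  have disj: "insert (x, b) f \<notin> placements R p r A B k l" for f b k l
    using nx by fastforce
  have inj: "inj_on (\<lambda>(f, b). insert (x, b) f) ?S"
  proof (rule inj_onI, clarify)
    fix f b g d
    assume "f \<in> placements R p r A B i (Suc j)" "g \<in> placements R p r A B i (Suc j)"
      and eq: "insert (x, b) f = insert (x, d) g"
    then have "x \<notin> Domain f" "x \<notin> Domain g" using nx by auto
    then show "f = g \<and> b = d" using eq by (metis Domain.DomainI insert_ident insert_iff prod.inject)
  qed
  have "card ?S = (\<Sum>f\<in>placements R p r A B i (Suc j). Suc j)"
    using fin by (subst card_SigmaI) (auto simp: finite_placements placements_def)
  then have M: "card ((\<lambda>(f, b). insert (x, b) f) ` ?S) =
      Suc j * card (placements R p r A B i (Suc j))"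
    by (simp add: card_image[OF inj])
  have "finite ?S" using fin by (auto simp: finite_placements)
  then show ?thesis
    by (subst placements_insert_row[where c = c], use fin x c in simp_all,
        subst card_Un_disjoint) (use fin disj in \<open>auto simp: finite_placements M\<close>)
qed

lemma card_placements_insert_col:
  assumes "finite A" "finite B" "y \<notin> B"
    and "\<And>a. a \<in> A \<Longrightarrow> R a y \<longleftrightarrow> c \<and> p a"
  shows "card (placements R p r A (insert y B) i j) =
    (if r y \<and> j > 0 then card (placements R p r A B i (j - 1)) else 0) +
    (if c then Suc i * card (placements R p r A B (Suc i) j) else 0)"
  using card_placements_insert_row[of B A y "\<lambda>b a. R a b" c p r j i] assms
  by (simp add: card_placements_converse[of R])

text \<open>A placement with nothing open is the graph of a permutation, whatever \<open>p\<close>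
  and \<open>r\<close> are, so each problem can choose them to fit its recursion.\<close>

lemma card_permutes_placements:
  assumes "finite S"
  shows "card {\<sigma>. \<sigma> permutes S \<and> (\<forall>i\<in>S. R i (\<sigma> i))} = card (placements R p r S S 0 0)"
proof (rule bij_betw_same_card)
  let ?g = "\<lambda>\<sigma>. (\<lambda>i. (i, \<sigma> i)) ` S"
  \<comment> \<open>\<open>permutes\<close> demands the identity outside \<open>S\<close>.\<close>
  let ?h = "\<lambda>f i. if i \<in> S then THE b. (i, b) \<in> f else i"
  show "bij_betw ?g {\<sigma>. \<sigma> permutes S \<and> (\<forall>i\<in>S. R i (\<sigma> i))} (placements R p r S S 0 0)"
  proof (rule bij_betwI[where g = ?h])
    show "?g \<in> {\<sigma>. \<sigma> permutes S \<and> (\<forall>i\<in>S. R i (\<sigma> i))} \<rightarrow> placements R p r S S 0 0"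
    proof
      fix \<sigma> assume "\<sigma> \<in> {\<sigma>. \<sigma> permutes S \<and> (\<forall>i\<in>S. R i (\<sigma> i))}"
      then have s: "\<sigma> permutes S" "\<forall>i\<in>S. R i (\<sigma> i)" by auto
      have D: "Domain (?g \<sigma>) = S" by force
      have "Range (?g \<sigma>) = \<sigma> ` S" by force
      then have Rg: "Range (?g \<sigma>) = S" using permutes_image[OF s(1)] by simp
      show "?g \<sigma> \<in> placements R p r S S 0 0"
        unfolding placements_def mem_Collect_eq D Rg
        using s(2) permutes_in_image[OF s(1)] permutes_inj[OF s(1)]
        by (auto simp: single_valued_def dest: injD)
    qed
    have h: "(i, ?h f i) \<in> f \<and> (\<forall>b. (i, b) \<in> f \<longrightarrow> b = ?h f i)"
      if "f \<in> placements R p r S S 0 0" "i \<in> S" for f i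
    proof -
      have "card (S - Domain f) = 0" "single_valued f" using that(1) by (auto simp: placements_def)
      then have "\<exists>!b. (i, b) \<in> f" using that(2) assms by (auto simp: single_valued_def)
      then show ?thesis using theI'[of "\<lambda>b. (i, b) \<in> f"] that(2) by auto
    qed
    show "?h \<in> placements R p r S S 0 0 \<rightarrow> {\<sigma>. \<sigma> permutes S \<and> (\<forall>i\<in>S. R i (\<sigma> i))}"
    proof
      fix f assume f: "f \<in> placements R p r S S 0 0"
      have sub: "f \<subseteq> S \<times> S" using f by (auto simp: placements_def)
      have "?h f ` S \<subseteq> S"
      proof (rule image_subsetI)
        fix i assume "i \<in> S"
        then show "?h f i \<in> S" using h[OF f, of i] sub by blast
      qed
      moreover have "inj_on (?h f) S"
      proof (rule inj_onI)
        fix i k assume "i \<in> S" "k \<in> S" "?h f i = ?h f k"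
        then have "(i, ?h f i) \<in> f" "(k, ?h f i) \<in> f" using h[OF f] by metis+
        moreover have "single_valued (f\<inverse>)" using f by (simp add: placements_def)
        ultimately show "i = k" by (meson converse_iff single_valuedD)
      qed
      ultimately have "bij_betw (?h f) S S"
        using endo_inj_surj[OF assms] unfolding bij_betw_def by blast
      then have "?h f permutes S" by (rule bij_imp_permutes) simp
      moreover have "\<forall>i\<in>S. R i (?h f i)"
      proof
        fix i assume "i \<in> S"
        moreover have "\<forall>(a, b)\<in>f. R a b" using f by (simp add: placements_def)
        ultimately show "R i (?h f i)" using h[OF f, of i] by blast
      qed
      ultimately show "?h f \<in> {\<sigma>. \<sigma> permutes S \<and> (\<forall>i\<in>S. R i (\<sigma> i))}" by blast
    qed
    show "?h (?g \<sigma>) = \<sigma>" if "\<sigma> \<in> {\<sigma>. \<sigma> permutes S \<and> (\<forall>i\<in>S. R i (\<sigma> i))}" for \<sigma>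
    proof
      fix i
      have "(i, b) \<in> ?g \<sigma> \<longleftrightarrow> i \<in> S \<and> b = \<sigma> i" for b by auto
      then show "?h (?g \<sigma>) i = \<sigma> i" using that permutes_not_in[of \<sigma> S i] by simp
    qed
    show "?g (?h f) = f" if f: "f \<in> placements R p r S S 0 0" for f
    proof -
      have sub: "f \<subseteq> S \<times> S" using f by (auto simp: placements_def)
      show ?thesis
      proof (intro equalityI subsetI)
        fix z assume "z \<in> ?g (?h f)"
        then obtain i where "i \<in> S" "z = (i, ?h f i)" by blast
        then show "z \<in> f" using h[OF f, of i] by simp
      next
        fix z assume z: "z \<in> f"
        then obtain i b where ib: "z = (i, b)" "i \<in> S" using sub by blast
        then have "b = ?h f i" using h[OF f, of i] z by blast
        then show "z \<in> ?g (?h f)" using ib by blast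
      qed
    qed
  qed
qed

text \<open>With each row added before its column, a waiting row later gets a column at least as
  large, which is no drop, so any row may wait. A waiting column gets a larger row, hence a drop, so
  it must be odd.\<close>

definition even_odd_count :: "nat \<Rightarrow> nat \<Rightarrow> nat \<Rightarrow> nat \<Rightarrow> nat" where
  "even_odd_count m n i j =
    card (placements (\<lambda>i j. j < i \<longrightarrow> even i \<and> odd j) (\<lambda>_. True) odd {1..m} {1..n} i j)"

text \<open>A waiting row later gets a larger column, so it must be odd; a waiting column gets a
  larger, even row, so any column may wait.\<close>

definition dumont_count :: "nat \<Rightarrow> nat \<Rightarrow> nat \<Rightarrow> nat \<Rightarrow> nat" where
  "dumont_count m n i j =
    card (placements (\<lambda>i j. if even i then j < i else i < j) odd (\<lambda>_. True) {1..m} {1..n} i j)"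

section \<open>Recursions for the two counts\<close>

lemma even_odd_count_0: "even_odd_count 0 0 i j = of_bool (i = 0 \<and> j = 0)"
  by (simp add: even_odd_count_def card_placements_empty)

lemma dumont_count_0: "dumont_count 0 0 i j = of_bool (i = 0 \<and> j = 0)"
  by (simp add: dumont_count_def card_placements_empty)

lemma atLeast1_atMost_Suc: "{1..Suc n} = insert (Suc n) {1..n}"
  by auto

lemma even_odd_count_row:
  "even_odd_count (Suc n) n i j =
    (if i > 0 then even_odd_count n n (i - 1) j else 0) +
    (if odd n then Suc j * even_odd_count n n i (Suc j) else 0)"
  unfolding even_odd_count_def atLeast1_atMost_Suc
  by (subst card_placements_insert_row[where c = "odd n"]) auto

lemma even_odd_count_col:
  "even_odd_count (Suc n) (Suc n) i j =
    (if even n \<and> j > 0 then even_odd_count (Suc n) n i (j - 1) else 0) +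
    Suc i * even_odd_count (Suc n) n (Suc i) j"
  unfolding even_odd_count_def atLeast1_atMost_Suc[of n]
  by (subst card_placements_insert_col[where c = True]) auto

text \<open>Odd labels add the column first, even labels the row. The second line then cannot pair
  with the first: an odd row fits no column present, and an even row is never left open. This
  excludes fixed points.\<close>

lemma dumont_count_col_odd:
  assumes "even n"
  shows "dumont_count n (Suc n) i j =
    (if j > 0 then dumont_count n n i (j - 1) else 0) + Suc i * dumont_count n n (Suc i) j"
  unfolding dumont_count_def atLeast1_atMost_Suc
  by (subst card_placements_insert_col[where c = True]) auto

lemma dumont_count_row_odd:
  assumes "even n"
  shows "dumont_count (Suc n) (Suc n) i j =
    (if i > 0 then dumont_count n (Suc n) (i - 1) j else 0)"
  unfolding dumont_count_def atLeast1_atMost_Suc[of n]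
  by (subst card_placements_insert_row[where c = False]) (use assms in auto)

lemma dumont_count_row_even:
  assumes "odd n"
  shows "dumont_count (Suc n) n i j = Suc j * dumont_count n n i (Suc j)"
  unfolding dumont_count_def atLeast1_atMost_Suc
  by (subst card_placements_insert_row[where c = True]) (use assms in auto)

lemma dumont_count_col_even:
  assumes "odd n"
  shows "dumont_count (Suc n) (Suc n) i j =
    (if j > 0 then dumont_count (Suc n) n i (j - 1) else 0) +
    Suc i * dumont_count (Suc n) n (Suc i) j"
  unfolding dumont_count_def atLeast1_atMost_Suc[of n]
  by (subst card_placements_insert_col[where c = True]) (use assms in auto)

text \<open>On \<open>i = j\<close> the recursions close up over a full label. This one is
  \<open>A'\<close>; the next three are \<open>B'\<close>, \<open>A\<close> and
  \<open>B\<close>.\<close>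

lemma even_odd_count_Suc_odd:
  "even n \<Longrightarrow> even_odd_count (Suc n) (Suc n) k k =
    Suc k * even_odd_count n n k k +
    (if k > 0 then even_odd_count n n (k - 1) (k - 1) else 0)"
  by (simp add: even_odd_count_row even_odd_count_col)

lemma even_odd_count_Suc_even:
  "odd n \<Longrightarrow> even_odd_count (Suc n) (Suc n) k k =
    Suc k * (even_odd_count n n k k + Suc k * even_odd_count n n (Suc k) (Suc k))"
  by (simp add: even_odd_count_row even_odd_count_col)

lemma dumont_count_Suc_odd:
  "even n \<Longrightarrow> dumont_count (Suc n) (Suc n) k k =
    k * dumont_count n n k k + (if k > 0 then dumont_count n n (k - 1) (k - 1) else 0)"
  by (simp add: dumont_count_row_odd dumont_count_col_odd)

lemma dumont_count_Suc_even:
  "odd n \<Longrightarrow> dumont_count (Suc n) (Suc n) k k =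
    k * dumont_count n n k k + Suc k * Suc k * dumont_count n n (Suc k) (Suc k)"
  by (cases k) (simp_all add: dumont_count_row_even dumont_count_col_even algebra_simps)

text \<open>The induction step is \<open>BA = A'B'\<close>.\<close>

lemma dumont_count_eq_even_odd_count:
  "dumont_count (Suc (Suc (2 * n))) (Suc (Suc (2 * n))) k k =
   even_odd_count (Suc (2 * n)) (Suc (2 * n)) k k"
proof (induction n arbitrary: k)
  case 0
  \<comment> \<open>\<open>BA\<close> and \<open>A'\<close> agree on \<open>e\<^sub>0\<close>, since
    \<open>B'\<close> fixes it.\<close>
  show ?case
    by (simp add: dumont_count_Suc_even dumont_count_Suc_odd dumont_count_0
        even_odd_count_Suc_odd even_odd_count_0)
next
  case (Suc n)
  let ?m = "Suc (2 * n)"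
  \<comment> \<open>Two Dumont steps from size \<open>2 * n + 2\<close> are compared with two
    even-odd steps from \<open>2 * n + 1\<close>; the induction hypothesis identifies the starting
    values.\<close>
  have "even (Suc ?m)" "odd (Suc (Suc ?m))" "odd ?m" by simp_all
  note steps = dumont_count_Suc_odd[OF this(1)] dumont_count_Suc_even[OF this(2)]
    even_odd_count_Suc_odd[OF this(1)] even_odd_count_Suc_even[OF this(3)]
  have "2 * Suc n = Suc ?m" by simp
  then show ?case
    by (cases k) (simp_all only: steps Suc.IH, simp_all add: algebra_simps)
qed

theorem corollary6p2:
  fixes n :: nat
  assumes "n \<ge> 1"
  shows "median_genocchi n =
    card {\<sigma>. \<sigma> permutes {1..2*n} \<and> only_even_odd_drops {1..2*n} \<sigma>}"
proof -
  have iff: "dumont_derangement (n + 1) \<sigma> \<longleftrightarrow> \<sigma> permutes {1..Suc (Suc (2*n))} \<and>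
      (\<forall>i\<in>{1..Suc (Suc (2*n))}. if even i then \<sigma> i < i else i < \<sigma> i)" for \<sigma>
  proof -
    have "(\<forall>i\<in>{1..n+1}. 2*i > \<sigma> (2*i) \<and> 2*i - 1 < \<sigma> (2*i - 1)) \<longleftrightarrow>
      (\<forall>i\<in>{1..Suc (Suc (2*n))}. if even i then \<sigma> i < i else i < \<sigma> i)" (is "?l \<longleftrightarrow> ?r")
    proof
      assume l: ?l
      show ?r
      proof
        fix i assume i: "i \<in> {1..Suc (Suc (2*n))}"
        show "if even i then \<sigma> i < i else i < \<sigma> i"
        proof (cases "even i")
          case True
          then obtain k where "i = 2 * k" by blast
          then show ?thesis using l i by auto
        next
          case False
          \<comment> \<open>The odd number \<open>2 * k + 1\<close> is
            \<open>2 * (k + 1) - 1\<close>, hence the index \<open>k + 1\<close>.\<close>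
          then obtain k where "i = 2 * k + 1" by (auto elim: oddE)
          then show ?thesis using bspec[OF l, of "k + 1"] i by auto
        qed
      qed
    next
      assume r: ?r
      show ?l
      proof
        fix i assume i: "i \<in> {1..n+1}"
        then have "2*i \<in> {1..Suc (Suc (2*n))}" "2*i - 1 \<in> {1..Suc (Suc (2*n))}" by auto
        then show "2*i > \<sigma> (2*i) \<and> 2*i - 1 < \<sigma> (2*i - 1)"
          using bspec[OF r, of "2*i"] bspec[OF r, of "2*i - 1"] i by (simp del: atLeastAtMost_iff)
      qed
    qed
    then show ?thesis by (simp add: dumont_derangement_def)
  qed
  have "median_genocchi n = dumont_count (Suc (Suc (2 * n))) (Suc (Suc (2 * n))) 0 0"
    unfolding median_genocchi_def iff dumont_count_def
    by (rule card_permutes_placements) simp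
  \<comment> \<open>The largest label \<open>2 * n + 1\<close> is odd and cannot drop, so it is a
    fixed point and can be removed.\<close>
  also have "\<dots> = even_odd_count (2 * n) (2 * n) 0 0"
    using dumont_count_eq_even_odd_count[of n 0] even_odd_count_Suc_odd[of "2 * n" 0] by simp
  also have "\<dots> = card {\<sigma>. \<sigma> permutes {1..2*n} \<and> only_even_odd_drops {1..2*n} \<sigma>}"
    unfolding even_odd_count_def only_even_odd_drops_def
    by (rule card_permutes_placements[symmetric]) simp
  finally show ?thesis .
qed

end
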